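(* Suppose $G\curvearrowright X$ is a geometric Gelfand pair and $Y$ is a metric space so that every bornologous map $X\to Y$ is insolvent. Then every continuous isometric action $G\curvearrowright Y$ has bounded orbits.
   Context: A map $\phi\colon (X,d)\to (Y,\partial)$ between metric spaces is bornologous if $\sup\{\partial(\phi(a),\phi(b)):d(a,b)\leqslant t\}<\infty$ for all $t<\infty$. It is solvent if for every $n\geqslant1$ there is a constant $R$ such that $R\leqslant d(x,y)\leqslant R+n$ implies $\partial(\phi(x),\phi(y))\geqslant n$; it is insolvent if it is not solvent. An écart is a pseudometric. The left-coarse structure $\mathcal E_L$ of a topological group $G$ is the family of all $A\subseteq G\times G$ such that $\sup_{(x,y)\in A}d(x,y)<\infty$ for every continuous left-invariant écart $d$ on $G$. A map $\sigma\colon G\to (X,d)$ into a metric space is a coarse embedding if $\sup_{(g,f)\in A}d(\sigma(g),\sigma(f))<\infty$ for every $A\in\mathcal E_L$ and, for every $C<\infty$, $\{(g,f): d(\sigma(g),\sigma(f))\leqslant C\}\in\mathcal E_L$. A continuous isometric action $G\curvearrowright X$ on a metric space is coarsely proper if the orbit maps $g\in G\mapsto g(x)\in X$ are coarse embeddings. A geometric Gelfand pair is a coarsely proper continuous isometric action $G\curvearrowright X$ of a topological group $G$ on a metric space $X$ such that, for some constant $K$ and all $x,y,z,u\in X$ with $d(x,y)\leqslant d(z,u)$, there is $g\in G$ with $d(g(x),z)<K$ and $d(z,g(y))+d(g(y),u)<d(z,u)+K$. *)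

theory Defs
  imports "HOL-Analysis.Analysis" "HOL-Algebra.Group_Action"
begin

text \<open>All spaces are given by explicit carriers, so empty spaces are allowed. Suprema over
  possibly empty sets of reals are only compared with infinity, hence
  \<open>sup S < \<infinity>\<close> is rendered as \<^term>\<open>bdd_above S\<close>.\<close>

definition bornologous ::
  "'x set \<Rightarrow> ('x \<Rightarrow> 'x \<Rightarrow> real) \<Rightarrow> ('y \<Rightarrow> 'y \<Rightarrow> real) \<Rightarrow> ('x \<Rightarrow> 'y) \<Rightarrow> bool" where
  "bornologous X dX dY \<phi> \<longleftrightarrow>
     (\<forall>t. bdd_above {dY (\<phi> a) (\<phi> b) | a b. a \<in> X \<and> b \<in> X \<and> dX a b \<le> t})"

text \<open>The constant \<open>R\<close> has to be nonnegative: for \<open>R < -n\<close> the condition would be vacuous, and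
  every map would be solvent.\<close>

definition solvent ::
  "'x set \<Rightarrow> ('x \<Rightarrow> 'x \<Rightarrow> real) \<Rightarrow> ('y \<Rightarrow> 'y \<Rightarrow> real) \<Rightarrow> ('x \<Rightarrow> 'y) \<Rightarrow> bool" where
  "solvent X dX dY \<phi> \<longleftrightarrow>
     (\<forall>n::nat. 1 \<le> n \<longrightarrow> (\<exists>R::real. 0 \<le> R \<and>
        (\<forall>x\<in>X. \<forall>y\<in>X. R \<le> dX x y \<and> dX x y \<le> R + real n \<longrightarrow> real n \<le> dY (\<phi> x) (\<phi> y))))"

abbreviation insolvent ::
  "'x set \<Rightarrow> ('x \<Rightarrow> 'x \<Rightarrow> real) \<Rightarrow> ('y \<Rightarrow> 'y \<Rightarrow> real) \<Rightarrow> ('x \<Rightarrow> 'y) \<Rightarrow> bool" where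
  "insolvent X dX dY \<phi> \<equiv> \<not> solvent X dX dY \<phi>"

text \<open>No separation axiom is imposed.\<close>

locale topological_group = group G for G (structure) +
  fixes T :: "'g topology"
  assumes topspace_eq: "topspace T = carrier G"
    and continuous_mult: "continuous_map (prod_topology T T) T (\<lambda>(x, y). x \<otimes> y)"
    and continuous_inv: "continuous_map T T (\<lambda>x. inv x)"

definition ecart :: "'g set \<Rightarrow> ('g \<Rightarrow> 'g \<Rightarrow> real) \<Rightarrow> bool" where
  "ecart S d \<longleftrightarrow>
     (\<forall>x\<in>S. d x x = 0) \<and>
     (\<forall>x\<in>S. \<forall>y\<in>S. 0 \<le> d x y \<and> d x y = d y x) \<and>
     (\<forall>x\<in>S. \<forall>y\<in>S. \<forall>z\<in>S. d x z \<le> d x y + d y z)"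

definition continuous_left_invariant_ecart ::
  "('g, 'b) monoid_scheme \<Rightarrow> 'g topology \<Rightarrow> ('g \<Rightarrow> 'g \<Rightarrow> real) \<Rightarrow> bool" where
  "continuous_left_invariant_ecart G T d \<longleftrightarrow>
     ecart (carrier G) d \<and>
     continuous_map (prod_topology T T) euclideanreal (\<lambda>(x, y). d x y) \<and>
     (\<forall>g\<in>carrier G. \<forall>x\<in>carrier G. \<forall>y\<in>carrier G. d (g \<otimes>\<^bsub>G\<^esub> x) (g \<otimes>\<^bsub>G\<^esub> y) = d x y)"

definition left_coarse_structure ::
  "('g, 'b) monoid_scheme \<Rightarrow> 'g topology \<Rightarrow> ('g \<times> 'g) set set" where
  "left_coarse_structure G T =
     {A. A \<subseteq> carrier G \<times> carrier G \<and>
         (\<forall>d. continuous_left_invariant_ecart G T d \<longrightarrow> bdd_above ((\<lambda>(x, y). d x y) ` A))}"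

definition coarse_embedding ::
  "('g, 'b) monoid_scheme \<Rightarrow> 'g topology \<Rightarrow> 'x set \<Rightarrow> ('x \<Rightarrow> 'x \<Rightarrow> real) \<Rightarrow> ('g \<Rightarrow> 'x) \<Rightarrow> bool" where
  "coarse_embedding G T X d \<sigma> \<longleftrightarrow>
     \<sigma> \<in> carrier G \<rightarrow> X \<and>
     (\<forall>A\<in>left_coarse_structure G T. bdd_above ((\<lambda>(g, f). d (\<sigma> g) (\<sigma> f)) ` A)) \<and>
     (\<forall>C. {(g, f). g \<in> carrier G \<and> f \<in> carrier G \<and> d (\<sigma> g) (\<sigma> f) \<le> C}
            \<in> left_coarse_structure G T)"

text \<open>Continuity is joint continuity of \<open>(g, x) \<mapsto> g(x)\<close>; for isometric actions this is the same
  as continuity of all orbit maps.\<close>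

locale continuous_isometric_action =
  topological_group G T + group_action G X \<alpha> + Metric_space X d
  for G :: "('g, 'b) monoid_scheme" (structure) and T :: "'g topology"
    and X :: "'x set" and d :: "'x \<Rightarrow> 'x \<Rightarrow> real" and \<alpha> :: "'g \<Rightarrow> 'x \<Rightarrow> 'x" +
  assumes continuous_action:
      "continuous_map (prod_topology T mtopology) mtopology (\<lambda>(g, x). \<alpha> g x)"
    and isometric: "\<lbrakk>g \<in> carrier G; x \<in> X; y \<in> X\<rbrakk> \<Longrightarrow> d (\<alpha> g x) (\<alpha> g y) = d x y"

locale coarsely_proper_action = continuous_isometric_action +
  assumes coarsely_proper: "x \<in> X \<Longrightarrow> coarse_embedding G T X d (\<lambda>g. \<alpha> g x)"

locale geometric_Gelfand_pair = coarsely_proper_action +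
  assumes geometric_Gelfand:
    "\<exists>K::real. \<forall>x\<in>X. \<forall>y\<in>X. \<forall>z\<in>X. \<forall>u\<in>X. d x y \<le> d z u \<longrightarrow>
       (\<exists>g\<in>carrier G. d (\<alpha> g x) z < K \<and> d z (\<alpha> g y) + d (\<alpha> g y) u < d z u + K)"

end

theory Submission
  imports Defs
begin

text \<open>Fix base points \<open>x0\<close> and \<open>y0\<close>. Coarse properness of the action on \<open>X\<close> says that a bound on
  \<open>d(g x0, f x0)\<close> gives a bound on \<open>\<partial>(g y0, f y0)\<close>, and the Gelfand condition with \<open>x = y\<close> says that
  the orbit of \<open>x0\<close> is cobounded. Hence sending \<open>x\<close> to \<open>g y0\<close>, where \<open>g x0\<close> is near \<open>x\<close>, is
  bornologous, therefore insolvent, which yields an \<open>n\<close> and at every scale \<open>R\<close> an element \<open>h\<close>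
  with \<open>d(x0, h x0)\<close> close to \<open>R\<close> and \<open>\<partial>(y0, h y0) < n\<close>. Given \<open>g\<close>, choose such an \<open>h\<close> with
  \<open>d(x0, h x0)\<close> slightly larger than \<open>d(x0, g x0)\<close>; the Gelfand condition supplies \<open>k\<close> with
  \<open>k x0\<close> near \<open>x0\<close> and \<open>k g x0\<close> near \<open>h x0\<close>, so \<open>\<partial>(y0, g y0) = \<partial>(k y0, k g y0)\<close> is bounded
  independently of \<open>g\<close>.\<close>

context continuous_isometric_action
begin

text \<open>The left-coarse structure is tested on continuous left-invariant ecarts. Pulling the
  metric back along an orbit map gives one, since \<open>g\<close> acts by an isometry.\<close>

lemma continuous_left_invariant_ecart_orbit:
  assumes x: "x \<in> X"
  shows "continuous_left_invariant_ecart G T (\<lambda>g f. d (\<alpha> g x) (\<alpha> f x))"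
proof -
  have in_X: "\<alpha> g x \<in> X" if "g \<in> carrier G" for g
    using element_image[OF that x] by simp
  have "continuous_map T (prod_topology T mtopology) (\<lambda>g. (g, x))"
    using x by (simp add: continuous_map_pairedI)
  from continuous_map_compose[OF this continuous_action]
  have orbit_map: "continuous_map T mtopology (\<lambda>g. \<alpha> g x)"
    by (simp add: o_def)
  have "continuous_map (prod_topology T T) euclideanreal (\<lambda>p. d (\<alpha> (fst p) x) (\<alpha> (snd p) x))"
    using continuous_map_mdist[of "prod_topology T T" "metric (X, d)"
        "\<lambda>p. \<alpha> (fst p) x" "\<lambda>p. \<alpha> (snd p) x"]
      continuous_map_compose[OF continuous_map_fst orbit_map, of T]
      continuous_map_compose[OF continuous_map_snd orbit_map, of T]
    by (simp add: o_def mtopology_of)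
  moreover have "ecart (carrier G) (\<lambda>g f. d (\<alpha> g x) (\<alpha> f x))"
    unfolding ecart_def using in_X by (auto simp: commute intro!: triangle)
  moreover have "d (\<alpha> (g \<otimes> a) x) (\<alpha> (g \<otimes> b) x) = d (\<alpha> a x) (\<alpha> b x)"
    if "g \<in> carrier G" "a \<in> carrier G" "b \<in> carrier G" for g a b
    using that x in_X by (simp add: composition_rule isometric)
  ultimately show ?thesis
    unfolding continuous_left_invariant_ecart_def by (auto simp: case_prod_unfold)
qed

end

text \<open>Coarse properness puts the set of pairs with distance at most \<open>C\<close> into the
  left-coarse structure of \<open>G\<close>, which no longer mentions \<open>X\<close>; the ecart
  pulled back from \<open>Y\<close> is therefore bounded on it.\<close>

lemma (in coarsely_proper_action) orbit_map_controls_orbit_map: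
  assumes Y: "continuous_isometric_action G T Y dY \<beta>" and x: "x \<in> X" and y: "y \<in> Y"
  shows "\<exists>M. \<forall>g\<in>carrier G. \<forall>f\<in>carrier G.
           d (\<alpha> g x) (\<alpha> f x) \<le> C \<longrightarrow> dY (\<beta> g y) (\<beta> f y) \<le> M"
proof -
  let ?A = "{(g, f). g \<in> carrier G \<and> f \<in> carrier G \<and> d (\<alpha> g x) (\<alpha> f x) \<le> C}"
  have "?A \<in> left_coarse_structure G T"
    using coarsely_proper[OF x] by (simp add: coarse_embedding_def)
  then have "bdd_above ((\<lambda>(g, f). dY (\<beta> g y) (\<beta> f y)) ` ?A)"
    using continuous_isometric_action.continuous_left_invariant_ecart_orbit[OF Y y]
    by (force simp: left_coarse_structure_def)
  then show ?thesis
    unfolding bdd_above_def by fast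
qed

text \<open>The bound comes from factoring \<open>g\<close> as the product of \<open>inv k\<close>,
  \<open>h\<close> and \<open>inv h \<otimes> k \<otimes> g\<close>. The outer factors move
  \<open>x\<close> by at most \<open>K\<close> and \<open>L + 2 * K\<close>, hence move
  \<open>y\<close> boundedly, and \<open>h\<close> moves \<open>y\<close> by at most
  \<open>N\<close>; neither \<open>L\<close> nor \<open>N\<close> depends on the scale
  \<open>R\<close>.\<close>

lemma (in geometric_Gelfand_pair) orbits_bounded_if_small_displacements:
  assumes Y: "continuous_isometric_action G T Y dY \<beta>" and x: "x \<in> X" and y: "y \<in> Y"
    and small: "\<And>R. 0 \<le> R \<Longrightarrow> \<exists>h\<in>carrier G.
      R \<le> d x (\<alpha> h x) \<and> d x (\<alpha> h x) \<le> R + L \<and> dY y (\<beta> h y) \<le> N"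
  shows "\<exists>M. \<forall>g\<in>carrier G. dY y (\<beta> g y) \<le> M"
proof -
  interpret Y: continuous_isometric_action G T Y dY \<beta> by (rule Y)
  obtain K where K: "\<And>a b z u. \<lbrakk>a \<in> X; b \<in> X; z \<in> X; u \<in> X; d a b \<le> d z u\<rbrakk> \<Longrightarrow>
       \<exists>g\<in>carrier G. d (\<alpha> g a) z < K \<and> d z (\<alpha> g b) + d (\<alpha> g b) u < d z u + K"
    using geometric_Gelfand by blast
  have \<alpha>1: "\<alpha> \<one> x = x" and \<beta>1: "\<beta> \<one> y = y"
    using x y id_eq_one Y.id_eq_one by (metis restrict_apply')+
  have in_X: "\<alpha> g x \<in> X" and in_Y: "\<beta> g y \<in> Y" if "g \<in> carrier G" for g
    using element_image[OF that x] Y.element_image[OF that y] by simp_all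
  obtain M1 where M1: "\<And>g f. \<lbrakk>g \<in> carrier G; f \<in> carrier G; d (\<alpha> g x) (\<alpha> f x) \<le> K\<rbrakk> \<Longrightarrow>
      dY (\<beta> g y) (\<beta> f y) \<le> M1"
    using orbit_map_controls_orbit_map[OF Y x y] by blast
  obtain M2 where M2: "\<And>g f. \<lbrakk>g \<in> carrier G; f \<in> carrier G; d (\<alpha> g x) (\<alpha> f x) \<le> L + 2 * K\<rbrakk> \<Longrightarrow>
      dY (\<beta> g y) (\<beta> f y) \<le> M2"
    using orbit_map_controls_orbit_map[OF Y x y] by blast
  have "dY y (\<beta> g y) \<le> M1 + N + M2" if g: "g \<in> carrier G" for g
  proof -
    obtain h where h: "h \<in> carrier G" "d x (\<alpha> g x) \<le> d x (\<alpha> h x)"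
      "d x (\<alpha> h x) \<le> d x (\<alpha> g x) + L" "dY y (\<beta> h y) \<le> N"
      using small[of "d x (\<alpha> g x)"] by auto
    obtain k where k: "k \<in> carrier G" "d (\<alpha> k x) x < K"
      "d x (\<alpha> k (\<alpha> g x)) + d (\<alpha> k (\<alpha> g x)) (\<alpha> h x) < d x (\<alpha> h x) + K"
      using K[OF x in_X[OF g] x in_X[OF h(1)] h(2)] by blast
    have kg: "k \<otimes> g \<in> carrier G" "\<alpha> (k \<otimes> g) x = \<alpha> k (\<alpha> g x)" "\<beta> (k \<otimes> g) y = \<beta> k (\<beta> g y)"
      using k(1) g x y by (simp_all add: composition_rule Y.composition_rule)
    \<comment> \<open>Since \<open>k\<close> moves \<open>x\<close> by less than \<open>K\<close>,
      the distance from \<open>x\<close> to \<open>k g x\<close> exceeds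
      \<open>d x (\<alpha> g x) - K\<close>, while \<open>h\<close> moves \<open>x\<close> by at
      most \<open>d x (\<alpha> g x) + L\<close>. The Gelfand estimate adds another
      \<open>K\<close>, whence \<open>L + 2 * K\<close>.\<close>
    have "d x (\<alpha> g x) = d (\<alpha> k x) (\<alpha> (k \<otimes> g) x)"
      using isometric[OF k(1) x in_X[OF g]] kg by simp
    also have "\<dots> \<le> d (\<alpha> k x) x + d x (\<alpha> (k \<otimes> g) x)"
      using x in_X k(1) kg(1) by (intro triangle)
    finally have "d (\<alpha> (k \<otimes> g) x) (\<alpha> h x) \<le> L + 2 * K"
      using k(2) k(3)[folded kg(2)] h(3) by linarith
    then have 2: "dY (\<beta> (k \<otimes> g) y) (\<beta> h y) \<le> M2"
      using M2 kg(1) h(1) by blast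
    have 1: "dY (\<beta> k y) y \<le> M1"
      using M1[OF k(1) one_closed] k(2) by (simp add: \<alpha>1 \<beta>1)
    have "dY y (\<beta> g y) = dY (\<beta> k y) (\<beta> (k \<otimes> g) y)"
      using Y.isometric[OF k(1) y in_Y[OF g]] kg by simp
    also have "\<dots> \<le> dY (\<beta> k y) y + dY y (\<beta> (k \<otimes> g) y)"
      using y in_Y k(1) kg(1) by (intro Y.triangle)
    also have "dY y (\<beta> (k \<otimes> g) y) \<le> dY y (\<beta> h y) + dY (\<beta> h y) (\<beta> (k \<otimes> g) y)"
      using y in_Y h(1) kg(1) by (intro Y.triangle)
    finally show ?thesis
      using 1 2 h(4) by (simp add: Y.commute)
  qed
  then show ?thesis by blast
qed

theorem theorem11:
  fixes G :: "('g, 'b) monoid_scheme" and T :: "'g topology"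
    and X :: "'x set" and dX :: "'x \<Rightarrow> 'x \<Rightarrow> real" and \<alpha> :: "'g \<Rightarrow> 'x \<Rightarrow> 'x"
    and Y :: "'y set" and dY :: "'y \<Rightarrow> 'y \<Rightarrow> real"
  assumes "geometric_Gelfand_pair G T X dX \<alpha>"
    and "Metric_space Y dY"
    and "\<And>\<phi>. \<lbrakk>\<phi> \<in> X \<rightarrow> Y; bornologous X dX dY \<phi>\<rbrakk> \<Longrightarrow> insolvent X dX dY \<phi>"
  shows "\<forall>\<beta>. continuous_isometric_action G T Y dY \<beta> \<longrightarrow>
           (\<forall>y\<in>Y. Metric_space.mbounded Y dY (orbit G \<beta> y))"
proof (intro allI impI ballI)
  fix \<beta> y
  assume Y: "continuous_isometric_action G T Y dY \<beta>" and y: "y \<in> Y"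
  interpret geometric_Gelfand_pair G T X dX \<alpha> by (rule assms(1))
  interpret Y: continuous_isometric_action G T Y dY \<beta> by (rule Y)
  \<comment> \<open>On an empty \<open>X\<close> any function, even \<open>undefined\<close>, is
    vacuously both bornologous and solvent.\<close>
  have "X \<noteq> {}"
    using assms(3)[of undefined] by (auto simp: bornologous_def solvent_def)
  then obtain x where x: "x \<in> X" by blast
  have in_X: "\<alpha> g x \<in> X" and in_Y: "\<beta> g y \<in> Y" if "g \<in> carrier G" for g
    using element_image[OF that x] Y.element_image[OF that y] by simp_all
  obtain K where K: "\<forall>a\<in>X. \<forall>b\<in>X. \<forall>z\<in>X. \<forall>u\<in>X. dX a b \<le> dX z u \<longrightarrow>
       (\<exists>g\<in>carrier G. dX (\<alpha> g a) z < K \<and> dX z (\<alpha> g b) + dX (\<alpha> g b) u < dX z u + K)"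
    using geometric_Gelfand by blast
  have "\<exists>g\<in>carrier G. dX (\<alpha> g x) z < K" if "z \<in> X" for z
    using K[rule_format, OF x x that that] x that by auto
  then obtain s where s: "\<And>z. z \<in> X \<Longrightarrow> s z \<in> carrier G" "\<And>z. z \<in> X \<Longrightarrow> dX (\<alpha> (s z) x) z < K"
    by metis
  \<comment> \<open>Replacing \<open>z\<close> by \<open>\<alpha> (s z) x\<close> moves each
    endpoint by less than \<open>K\<close>; two triangle inequalities serve each direction.\<close>
  have near: "\<bar>dX (\<alpha> (s a) x) (\<alpha> (s b) x) - dX a b\<bar> \<le> 2 * K" if "a \<in> X" "b \<in> X" for a b
    using triangle[of "\<alpha> (s a) x" a "\<alpha> (s b) x"] triangle[of a b "\<alpha> (s b) x"]
      triangle[of a "\<alpha> (s a) x" b] triangle[of "\<alpha> (s a) x" "\<alpha> (s b) x" b]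
      s(2)[of a] s(2)[of b] that in_X s(1) commute[of a "\<alpha> (s a) x"] commute[of b "\<alpha> (s b) x"]
    by fastforce
  define \<phi> where "\<phi> z = \<beta> (s z) y" for z
  have "bornologous X dX dY \<phi>"
    unfolding bornologous_def
  proof
    fix t
    obtain M where M: "\<And>g f. \<lbrakk>g \<in> carrier G; f \<in> carrier G; dX (\<alpha> g x) (\<alpha> f x) \<le> t + 2 * K\<rbrakk> \<Longrightarrow>
        dY (\<beta> g y) (\<beta> f y) \<le> M"
      using orbit_map_controls_orbit_map[OF Y x y] by blast
    have "dY (\<phi> a) (\<phi> b) \<le> M" if "a \<in> X" "b \<in> X" "dX a b \<le> t" for a b
      unfolding \<phi>_def using near[OF that(1,2)] that s(1) by (intro M) auto
    then show "bdd_above {dY (\<phi> a) (\<phi> b) |a b. a \<in> X \<and> b \<in> X \<and> dX a b \<le> t}"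
      unfolding bdd_above_def by blast
  qed
  moreover have "\<phi> \<in> X \<rightarrow> Y"
    using in_Y s(1) by (simp add: \<phi>_def)
  ultimately have "insolvent X dX dY \<phi>"
    using assms(3) by blast
  then obtain n :: nat where n: "\<And>R. 0 \<le> R \<Longrightarrow>
      \<exists>a\<in>X. \<exists>b\<in>X. R \<le> dX a b \<and> dX a b \<le> R + real n \<and> dY (\<phi> a) (\<phi> b) < real n"
    unfolding solvent_def by (meson not_le)
  have "\<exists>M. \<forall>g\<in>carrier G. dY y (\<beta> g y) \<le> M"
  proof (rule orbits_bounded_if_small_displacements[OF Y x y])
    fix R :: real assume R: "0 \<le> R"
    \<comment> \<open>Insolvency is used at \<open>R + 2 * K\<close>, which must be nonnegative. The
      shift absorbs the error in \<open>near\<close> from below, and the error from above makes the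
      window \<open>real n + 4 * K\<close>.\<close>
    have "0 < K"
      using s(2)[OF x] nonneg[of "\<alpha> (s x) x" x] by linarith
    then obtain a b where ab: "a \<in> X" "b \<in> X" "R + 2 * K \<le> dX a b"
      "dX a b \<le> R + 2 * K + real n" "dY (\<phi> a) (\<phi> b) < real n"
      using n[of "R + 2 * K"] R by auto
    \<comment> \<open>Translating by the inverse of \<open>s a\<close> turns the pair
      \<open>a\<close>, \<open>b\<close> into displacements of the base points \<open>x\<close> and
      \<open>y\<close> by a single element.\<close>
    define h where "h = inv\<^bsub>G\<^esub> s a \<otimes>\<^bsub>G\<^esub> s b"
    have h: "h \<in> carrier G" "s b = s a \<otimes>\<^bsub>G\<^esub> h"
      using s(1) ab by (simp_all add: h_def m_assoc[symmetric])
    have "dX x (\<alpha> h x) = dX (\<alpha> (s a) x) (\<alpha> (s b) x)"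
      using isometric[OF s(1)[OF ab(1)] x in_X[OF h(1)]]
      by (simp add: h(2) composition_rule x s(1) ab(1) h(1))
    moreover have "dY y (\<beta> h y) = dY (\<phi> a) (\<phi> b)"
      using Y.isometric[OF s(1)[OF ab(1)] y in_Y[OF h(1)]]
      by (simp add: \<phi>_def h(2) Y.composition_rule y s(1) ab(1) h(1))
    ultimately show "\<exists>h\<in>carrier G. R \<le> dX x (\<alpha> h x) \<and> dX x (\<alpha> h x) \<le> R + (real n + 4 * K) \<and>
        dY y (\<beta> h y) \<le> real n"
      using near[OF ab(1,2)] ab h(1) by (intro bexI[of _ h]) auto
  qed
  then show "Y.mbounded (orbit G \<beta> y)"
    unfolding Y.mbounded_def orbit_def using y in_Y by (auto simp: mcball_def subset_iff)
qed

end
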